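(* Let $S$ be a semigroup and let $T$ be a subsemigroup of $S$ such that the set $S\setminus T$ is finite. If $S$ has a finite complete rewriting system, then $T$ has a finite complete rewriting system.
   Context: Semigroups and subsemigroups are nonempty. For a non-empty set $A$, $A^+$ and $A^*$ denote the free semigroup and the free monoid on $A$. A rewriting system $R$ over $A$ is a set of rules $U\to V$, i.e. a subset of $A^+\times A^+$. Write $W_1\to_R W_2$ if $W_1=Z_1XZ_2$ and $W_2=Z_1YZ_2$ for some $Z_1,Z_2\in A^*$ and some rule $X\to Y$ in $R$. The relation $\to_R^*$ is the reflexive transitive closure of $\to_R$, and $\leftrightarrow_R^*$ is its reflexive symmetric transitive closure, which is a congruence on $A^+$. A semigroup is presented by $[A;R]$ (equivalently, $[A;R]$ is a semigroup presentation for it) if it is isomorphic to $A^+/\leftrightarrow_R^*$. $R$ is Noetherian if there is no infinite sequence $W_1\to_R W_2\to_R W_3\to_R\cdots$. $R$ is confluent if whenever $U\to_R^*V$ and $U\to_R^*W$ there is $X\in A^+$ with $V\to_R^*X$ and $W\to_R^*X$. $R$ is complete if it is Noetherian and confluent. A semigroup has a finite complete rewriting system if it has a semigroup presentation $[A;R]$ with $A$ and $R$ both finite and $R$ complete. *)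

theory Defs
  imports Main
begin

definition is_semigroup :: "'a set \<Rightarrow> ('a \<Rightarrow> 'a \<Rightarrow> 'a) \<Rightarrow> bool" where
  "is_semigroup S mul \<longleftrightarrow>
     S \<noteq> {} \<and> (\<forall>x\<in>S. \<forall>y\<in>S. mul x y \<in> S) \<and>
     (\<forall>x\<in>S. \<forall>y\<in>S. \<forall>z\<in>S. mul (mul x y) z = mul x (mul y z))"

definition is_subsemigroup :: "'a set \<Rightarrow> 'a set \<Rightarrow> ('a \<Rightarrow> 'a \<Rightarrow> 'a) \<Rightarrow> bool" where
  "is_subsemigroup T S mul \<longleftrightarrow>
     T \<subseteq> S \<and> T \<noteq> {} \<and> (\<forall>x\<in>T. \<forall>y\<in>T. mul x y \<in> T)"

definition plus_words :: "'b set \<Rightarrow> 'b list set" where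
  "plus_words A = lists A - {[]}"

definition rewriting_system :: "'b set \<Rightarrow> ('b list \<times> 'b list) set \<Rightarrow> bool" where
  "rewriting_system A R \<longleftrightarrow> R \<subseteq> plus_words A \<times> plus_words A"

definition rstep :: "'b set \<Rightarrow> ('b list \<times> 'b list) set \<Rightarrow> 'b list \<Rightarrow> 'b list \<Rightarrow> bool" where
  "rstep A R W1 W2 \<longleftrightarrow>
     (\<exists>Z1 \<in> lists A. \<exists>Z2 \<in> lists A. \<exists>(X, Y) \<in> R. W1 = Z1 @ X @ Z2 \<and> W2 = Z1 @ Y @ Z2)"

definition word_cong :: "'b set \<Rightarrow> ('b list \<times> 'b list) set \<Rightarrow> ('b list \<times> 'b list) set" where
  "word_cong A R = {(U, V). U \<in> plus_words A \<and> V \<in> plus_words A \<and> equivclp (rstep A R) U V}"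

definition quot :: "'b set \<Rightarrow> ('b list \<times> 'b list) set \<Rightarrow> 'b list set set" where
  "quot A R = plus_words A // word_cong A R"

text \<open>The product of two congruence classes is the class containing all concatenations of
  their representatives; see \<open>quot_mul_class\<close>.\<close>

definition quot_mul ::
  "'b set \<Rightarrow> ('b list \<times> 'b list) set \<Rightarrow> 'b list set \<Rightarrow> 'b list set \<Rightarrow> 'b list set" where
  "quot_mul A R P Q = word_cong A R `` {U @ V | U V. U \<in> P \<and> V \<in> Q}"

definition semigroup_iso ::
  "('a \<Rightarrow> 'c) \<Rightarrow> 'a set \<Rightarrow> ('a \<Rightarrow> 'a \<Rightarrow> 'a) \<Rightarrow> 'c set \<Rightarrow> ('c \<Rightarrow> 'c \<Rightarrow> 'c) \<Rightarrow> bool" where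
  "semigroup_iso f S mul Q mul' \<longleftrightarrow>
     bij_betw f S Q \<and> (\<forall>x\<in>S. \<forall>y\<in>S. f (mul x y) = mul' (f x) (f y))"

definition presented_by ::
  "'a set \<Rightarrow> ('a \<Rightarrow> 'a \<Rightarrow> 'a) \<Rightarrow> 'b set \<Rightarrow> ('b list \<times> 'b list) set \<Rightarrow> bool" where
  "presented_by S mul A R \<longleftrightarrow>
     A \<noteq> {} \<and> rewriting_system A R \<and> (\<exists>f. semigroup_iso f S mul (quot A R) (quot_mul A R))"

definition noetherian_rs :: "'b set \<Rightarrow> ('b list \<times> 'b list) set \<Rightarrow> bool" where
  "noetherian_rs A R \<longleftrightarrow> \<not> (\<exists>W :: nat \<Rightarrow> 'b list. \<forall>i. rstep A R (W i) (W (Suc i)))"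

definition confluent_rs :: "'b set \<Rightarrow> ('b list \<times> 'b list) set \<Rightarrow> bool" where
  "confluent_rs A R \<longleftrightarrow>
     (\<forall>U \<in> plus_words A. \<forall>V \<in> plus_words A. \<forall>W \<in> plus_words A.
        (rstep A R)\<^sup>*\<^sup>* U V \<longrightarrow> (rstep A R)\<^sup>*\<^sup>* U W \<longrightarrow>
        (\<exists>X \<in> plus_words A. (rstep A R)\<^sup>*\<^sup>* V X \<and> (rstep A R)\<^sup>*\<^sup>* W X))"

definition complete_rs :: "'b set \<Rightarrow> ('b list \<times> 'b list) set \<Rightarrow> bool" where
  "complete_rs A R \<longleftrightarrow> noetherian_rs A R \<and> confluent_rs A R"

text \<open>The letters are natural numbers because a definition cannot quantify over the type of the
  alphabet. This loses nothing: the alphabet is finite, and all the notions above are invariant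
  under an injective renaming of the letters.\<close>

definition has_finite_complete_rs :: "'a set \<Rightarrow> ('a \<Rightarrow> 'a \<Rightarrow> 'a) \<Rightarrow> bool" where
  "has_finite_complete_rs S mul \<longleftrightarrow>
     (\<exists>(A :: nat set) R. finite A \<and> finite R \<and> presented_by S mul A R \<and> complete_rs A R)"

lemma equiv_word_cong: "equiv (plus_words A) (word_cong A R)"
proof (rule equivI)
  show "word_cong A R \<subseteq> plus_words A \<times> plus_words A"
    by (auto simp: word_cong_def)
  show "refl_on (plus_words A) (word_cong A R)"
    by (simp add: word_cong_def refl_on_def)
  show "sym (word_cong A R)"
    by (simp add: word_cong_def sym_def equivclp_sym)
  show "trans (word_cong A R)"
    unfolding word_cong_def trans_def by (blast intro: equivclp_trans)
qed

lemma rstep_context: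
  assumes "rstep A R U V" "P \<in> lists A" "Q \<in> lists A"
  shows "rstep A R (P @ U @ Q) (P @ V @ Q)"
proof -
  obtain Z1 Z2 X Y where "Z1 \<in> lists A" "Z2 \<in> lists A" "(X, Y) \<in> R"
    "U = Z1 @ X @ Z2" "V = Z1 @ Y @ Z2"
    using assms(1) by (auto simp: rstep_def)
  then show ?thesis
    using assms(2,3) unfolding rstep_def
    by (intro bexI[of _ "P @ Z1"] bexI[of _ "Z2 @ Q"] bexI[of _ "(X, Y)"]) auto
qed

lemma equivclp_rstep_context:
  assumes "equivclp (rstep A R) U V" "P \<in> lists A" "Q \<in> lists A"
  shows "equivclp (rstep A R) (P @ U @ Q) (P @ V @ Q)"
  using assms(1)
proof (induction rule: equivclp_induct)
  case base
  then show ?case by simp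
next
  case (step V W)
  then have "equivclp (rstep A R) (P @ V @ Q) (P @ W @ Q)"
    using rstep_context[OF _ assms(2,3)] by (metis equivclp_sym r_into_equivclp)
  with step.IH show ?case by (rule equivclp_trans)
qed

lemma word_cong_append:
  assumes "(U, U') \<in> word_cong A R" "(V, V') \<in> word_cong A R"
  shows "(U @ V, U' @ V') \<in> word_cong A R"
proof -
  have "equivclp (rstep A R) (U @ V) (U' @ V)"
    using equivclp_rstep_context[of A R U U' "[]" V] assms
    by (auto simp: word_cong_def plus_words_def)
  moreover have "equivclp (rstep A R) (U' @ V) (U' @ V')"
    using equivclp_rstep_context[of A R V V' U' "[]"] assms
    by (auto simp: word_cong_def plus_words_def)
  ultimately show ?thesis
    using assms by (auto simp: word_cong_def plus_words_def intro: equivclp_trans)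
qed

lemma quot_mul_class:
  assumes "U \<in> plus_words A" "V \<in> plus_words A"
  shows "quot_mul A R (word_cong A R `` {U}) (word_cong A R `` {V}) = word_cong A R `` {U @ V}"
proof (intro set_eqI iffI)
  fix W
  assume "W \<in> quot_mul A R (word_cong A R `` {U}) (word_cong A R `` {V})"
  then obtain U' V' where "(U, U') \<in> word_cong A R" "(V, V') \<in> word_cong A R"
    "(U' @ V', W) \<in> word_cong A R"
    unfolding quot_mul_def by blast
  then have "(U @ V, W) \<in> word_cong A R"
    using equiv_word_cong[of A R] word_cong_append by (metis equivE transD)
  then show "W \<in> word_cong A R `` {U @ V}" by simp
next
  fix W
  assume "W \<in> word_cong A R `` {U @ V}"
  moreover have "U \<in> word_cong A R `` {U}" "V \<in> word_cong A R `` {V}"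
    using assms by (simp_all add: word_cong_def)
  ultimately show "W \<in> quot_mul A R (word_cong A R `` {U}) (word_cong A R `` {V})"
    unfolding quot_mul_def by blast
qed

end

theory Submission
  imports Defs "HOL-Library.Countable"
begin

text \<open>Let $[A;R]$ be a finite complete presentation of $S$. The elements of $S - T$ have finitely
  many irreducible representatives, of length at most $k$ say, so every irreducible word of length
  greater than $k$ represents an element of $T$. Take as letters for $T$ the irreducible words of
  length at most $2k+1$ which represent elements of $T$. An irreducible word representing an element
  of $T$ has a canonical factorisation into such letters: cut off prefixes of length $k+1$ as long
  as at least $k+1$ symbols remain. The rules for $T$ replace each short non-canonical word $U$ over
  the letters by the canonical factorisation of the normal form of its concatenation.
  A word all of whose short factors are canonical is canonical, so normal forms
  correspond to elements of $T$. A rule either properly reduces the concatenation with respect to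
  $R$, or it keeps the concatenation and improves the factorisation.\<close>

section \<open>Complete systems and normal forms\<close>

definition irreducible_word :: "'b set \<Rightarrow> ('b list \<times> 'b list) set \<Rightarrow> 'b list \<Rightarrow> bool" where
  "irreducible_word A R U \<longleftrightarrow> (\<nexists>V. rstep A R U V)"

text \<open>A choice among irreducible descendants: \<open>complete_presentationI\<close> applies it
  to a system whose confluence is still to be shown.\<close>

definition normal_form :: "'b set \<Rightarrow> ('b list \<times> 'b list) set \<Rightarrow> 'b list \<Rightarrow> 'b list" where
  "normal_form A R U = (SOME V. (rstep A R)\<^sup>*\<^sup>* U V \<and> irreducible_word A R V)"

lemma plus_words_append:
  "U \<in> plus_words A \<Longrightarrow> V \<in> plus_words A \<Longrightarrow> U @ V \<in> plus_words A"
  by (auto simp: plus_words_def)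

lemma noetherian_rs_iff_wf: "noetherian_rs A R \<longleftrightarrow> wf {(V, U). rstep A R U V}"
  by (simp add: noetherian_rs_def wf_iff_no_infinite_down_chain)

lemma rstep_plus_words:
  assumes "rewriting_system A R" "rstep A R U V"
  shows "U \<in> plus_words A" "V \<in> plus_words A"
  using assms by (fastforce simp: rewriting_system_def rstep_def plus_words_def)+

lemma rsteps_plus_words:
  assumes "rewriting_system A R" "(rstep A R)\<^sup>*\<^sup>* U V" "U \<in> plus_words A"
  shows "V \<in> plus_words A"
  using assms(2,3) by (induction rule: rtranclp_induct) (auto dest: rstep_plus_words[OF assms(1)])

text \<open>The reversed orientation matches the first component of \<open>descent\<close>, where a
  reduction has to count as a decrease.\<close>

lemma rsteps_context:
  assumes "(rstep A R)\<^sup>+\<^sup>+ U V" "P \<in> lists A" "Q \<in> lists A"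
  shows "(P @ V @ Q, P @ U @ Q) \<in> {(V, U). rstep A R U V}\<^sup>+"
  using assms(1)
proof (induction rule: tranclp_induct)
  case (base V)
  then show ?case using rstep_context[OF _ assms(2,3)] by blast
next
  case (step V W)
  have "(P @ W @ Q, P @ V @ Q) \<in> {(V, U). rstep A R U V}"
    using rstep_context[OF step.hyps(2) assms(2,3)] by simp
  then show ?case using step.IH by (rule trancl_into_trancl2)
qed

lemma irreducible_word_factor:
  assumes "irreducible_word A R (P @ U @ Q)" "P \<in> lists A" "Q \<in> lists A"
  shows "irreducible_word A R U"
  using assms rstep_context unfolding irreducible_word_def by metis

lemma normal_form:
  assumes "noetherian_rs A R"
  shows "(rstep A R)\<^sup>*\<^sup>* U (normal_form A R U) \<and> irreducible_word A R (normal_form A R U)"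
proof -
  have "\<exists>V. (rstep A R)\<^sup>*\<^sup>* U V \<and> irreducible_word A R V"
    using assms[unfolded noetherian_rs_iff_wf]
  proof (induction U rule: wf_induct_rule)
    case (less U)
    show ?case
    proof (cases "irreducible_word A R U")
      case False
      then obtain V where "rstep A R U V" by (auto simp: irreducible_word_def)
      then show ?thesis using less[of V] by (auto intro: converse_rtranclp_into_rtranclp)
    qed auto
  qed
  then show ?thesis unfolding normal_form_def by (rule someI_ex)
qed

lemma rsteps_from_irreducible:
  assumes "(rstep A R)\<^sup>*\<^sup>* U V" "irreducible_word A R U"
  shows "V = U"
  using assms by (auto simp: irreducible_word_def elim: converse_rtranclpE)

text \<open>Induction along the zigzag: a backward step only lengthens the path to the meeting word,
  and a forward step leaves a fork that confluence closes. That \<open>U\<close> is a nonempty word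
  over \<open>A\<close> keeps the meeting word among those covered by
  \<open>confluent_rs\<close>.\<close>

lemma church_rosser:
  assumes rs: "rewriting_system A R" and conf: "confluent_rs A R"
    and "equivclp (rstep A R) U V" and U: "U \<in> plus_words A"
  shows "\<exists>X. (rstep A R)\<^sup>*\<^sup>* U X \<and> (rstep A R)\<^sup>*\<^sup>* V X"
  using assms(3)
proof (induction rule: equivclp_induct)
  case base
  then show ?case by blast
next
  case (step V W)
  then obtain X where X: "(rstep A R)\<^sup>*\<^sup>* U X" "(rstep A R)\<^sup>*\<^sup>* V X" by blast
  from step.hyps(2) show ?case
  proof
    assume "rstep A R V W"
    moreover from this have "V \<in> plus_words A" "W \<in> plus_words A"
      using rstep_plus_words[OF rs] by auto
    moreover have "X \<in> plus_words A"
      using X(1) U rsteps_plus_words[OF rs] by blast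
    ultimately obtain Y where "(rstep A R)\<^sup>*\<^sup>* X Y" "(rstep A R)\<^sup>*\<^sup>* W Y"
      using conf X(2) unfolding confluent_rs_def by (metis r_into_rtranclp)
    then show ?case using X(1) by (meson rtranclp_trans)
  next
    assume "rstep A R W V"
    then show ?case using X by (meson converse_rtranclp_into_rtranclp)
  qed
qed

section \<open>Evaluation maps of presentations\<close>

text \<open>Projecting to congruence classes and then inverting the isomorphism gives a map on
  words, so that the given presentation can be handled without classes.\<close>

lemma presented_by_evaluation:
  assumes "is_semigroup S mul" "presented_by S mul A R"
  obtains \<phi> where "\<phi> ` plus_words A = S"
    and "\<And>U V. U \<in> plus_words A \<Longrightarrow> V \<in> plus_words A \<Longrightarrow> \<phi> (U @ V) = mul (\<phi> U) (\<phi> V)"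
    and "\<And>U V. U \<in> plus_words A \<Longrightarrow> V \<in> plus_words A \<Longrightarrow>
           \<phi> U = \<phi> V \<longleftrightarrow> equivclp (rstep A R) U V"
proof -
  obtain f where bij: "bij_betw f S (quot A R)"
    and hom: "\<And>x y. x \<in> S \<Longrightarrow> y \<in> S \<Longrightarrow> f (mul x y) = quot_mul A R (f x) (f y)"
    using assms(2) by (auto simp: presented_by_def semigroup_iso_def)
  define cls where "cls U = word_cong A R `` {U}" for U
  have cls_image: "cls ` plus_words A = quot A R"
    by (auto simp: cls_def quot_def quotient_def)
  define \<phi> where "\<phi> U = inv_into S f (cls U)" for U
  have \<phi>_in: "\<phi> U \<in> S" and f_\<phi>: "f (\<phi> U) = cls U" if "U \<in> plus_words A" for U
  proof -
    have "cls U \<in> f ` S" using that bij cls_image by (auto simp: bij_betw_def)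
    then show "\<phi> U \<in> S" "f (\<phi> U) = cls U"
      by (auto simp: \<phi>_def inv_into_into f_inv_into_f)
  qed
  have inj: "inj_on f S" using bij by (simp add: bij_betw_def)
  have "\<phi> ` plus_words A = S"
    using bij bij_betw_inv_into[OF bij] cls_image
    by (metis (no_types, lifting) \<phi>_def bij_betw_def image_cong image_image)
  moreover have "\<phi> U = \<phi> V \<longleftrightarrow> equivclp (rstep A R) U V"
    if "U \<in> plus_words A" "V \<in> plus_words A" for U V
  proof -
    have "\<phi> U = \<phi> V \<longleftrightarrow> cls U = cls V"
      using that f_\<phi> \<phi>_def by metis
    also have "\<dots> \<longleftrightarrow> (U, V) \<in> word_cong A R"
      unfolding cls_def using eq_equiv_class_iff[OF equiv_word_cong that] .
    finally show ?thesis using that by (simp add: word_cong_def)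
  qed
  moreover have "\<phi> (U @ V) = mul (\<phi> U) (\<phi> V)"
    if UV: "U \<in> plus_words A" "V \<in> plus_words A" for U V
  proof -
    have "mul (\<phi> U) (\<phi> V) \<in> S \<and> f (mul (\<phi> U) (\<phi> V)) = cls (U @ V)"
      using assms(1) \<phi>_in UV hom f_\<phi> quot_mul_class[OF UV, of R]
      by (simp add: is_semigroup_def cls_def)
    then show ?thesis using inj f_\<phi> \<phi>_in plus_words_append[OF UV] by (metis inj_onD)
  qed
  ultimately show thesis using that by blast
qed

text \<open>Rules preserve \<open>\<phi>\<close>, so congruent words have equal values. Conversely,
  words with equal values reduce to irreducible words with equal values, which coincide by
  \<open>inj\<close>. This yields both confluence and the identification of the congruence with the
  kernel of \<open>\<phi>\<close>.\<close>

lemma complete_presentationI: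
  assumes "T \<noteq> {}" and rs: "rewriting_system B Q" and noeth: "noetherian_rs B Q"
    and onto: "\<phi> ` plus_words B = T"
    and hom: "\<And>U V. U \<in> plus_words B \<Longrightarrow> V \<in> plus_words B \<Longrightarrow> \<phi> (U @ V) = mul (\<phi> U) (\<phi> V)"
    and rules: "\<And>U V. (U, V) \<in> Q \<Longrightarrow> \<phi> U = \<phi> V"
    and inj: "\<And>U V. U \<in> plus_words B \<Longrightarrow> V \<in> plus_words B \<Longrightarrow> irreducible_word B Q U \<Longrightarrow>
                irreducible_word B Q V \<Longrightarrow> \<phi> U = \<phi> V \<Longrightarrow> U = V"
  shows "presented_by T mul B Q \<and> complete_rs B Q"
proof -
  have "\<phi> U = \<phi> V" if "rstep B Q U V" for U V
  proof -
    from that obtain Z1 Z2 X Y where Z: "Z1 \<in> lists B" "Z2 \<in> lists B" and XY: "(X, Y) \<in> Q"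
      and UV: "U = Z1 @ X @ Z2" "V = Z1 @ Y @ Z2"
      by (auto simp: rstep_def)
    have XY': "X \<in> plus_words B" "Y \<in> plus_words B"
      using XY rs by (auto simp: rewriting_system_def)
    \<comment> \<open>\<open>hom\<close> speaks of nonempty words, so an empty context is treated
      separately, here and then on the left.\<close>
    have right: "\<phi> (X @ Z2) = \<phi> (Y @ Z2)"
      using Z(2) XY' rules[OF XY] hom by (cases "Z2 = []") (auto simp: plus_words_def)
    have "X @ Z2 \<in> plus_words B" "Y @ Z2 \<in> plus_words B"
      using XY' Z(2) by (auto simp: plus_words_def)
    then have "\<phi> (Z1 @ (X @ Z2)) = \<phi> (Z1 @ (Y @ Z2))"
      using Z(1) right hom by (cases "Z1 = []") (auto simp: plus_words_def)
    then show ?thesis by (simp add: UV)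
  qed
  note step_eq = this
  have steps_eq: "\<phi> U = \<phi> V" if "(rstep B Q)\<^sup>*\<^sup>* U V" for U V
    using that by (induction rule: rtranclp_induct) (auto dest: step_eq)
  have equiv_eq: "\<phi> U = \<phi> V" if "equivclp (rstep B Q) U V" for U V
    using that by (induction rule: equivclp_induct) (auto dest: step_eq)
  have join: "\<exists>X\<in>plus_words B. (rstep B Q)\<^sup>*\<^sup>* U X \<and> (rstep B Q)\<^sup>*\<^sup>* V X"
    if U: "U \<in> plus_words B" and V: "V \<in> plus_words B" and eq: "\<phi> U = \<phi> V" for U V
  proof -
    let ?U = "normal_form B Q U" and ?V = "normal_form B Q V"
    note nU = normal_form[OF noeth, of U] and nV = normal_form[OF noeth, of V]
    have in_plus: "?U \<in> plus_words B" "?V \<in> plus_words B"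
      using nU nV U V rsteps_plus_words[OF rs] by blast+
    moreover have "\<phi> ?U = \<phi> ?V" using nU nV eq steps_eq by metis
    ultimately have "?U = ?V" using inj nU nV by blast
    then show ?thesis using nU nV in_plus by metis
  qed
  have cong_iff: "(U, V) \<in> word_cong B Q \<longleftrightarrow> U \<in> plus_words B \<and> V \<in> plus_words B \<and> \<phi> U = \<phi> V"
    for U V
  proof -
    have "equivclp (rstep B Q) U V"
      if "U \<in> plus_words B" "V \<in> plus_words B" "\<phi> U = \<phi> V"
      using join[OF that] by (metis equivclp_sym equivclp_trans rtranclp_into_equivclp)
    then show ?thesis using equiv_eq by (auto simp: word_cong_def)
  qed
  \<comment> \<open>Two descendants of one word share its value, so \<open>join\<close> applies to
    them.\<close>
  have "confluent_rs B Q"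
    unfolding confluent_rs_def using join steps_eq by metis
  then have "complete_rs B Q" using noeth by (simp add: complete_rs_def)
  moreover have "B \<noteq> {}"
    using \<open>T \<noteq> {}\<close> onto by (auto simp: plus_words_def)
  moreover have "semigroup_iso (\<lambda>t. {U \<in> plus_words B. \<phi> U = t}) T mul (quot B Q) (quot_mul B Q)"
  proof -
    let ?f = "\<lambda>t. {U \<in> plus_words B. \<phi> U = t}"
    have f_\<phi>: "?f (\<phi> U) = word_cong B Q `` {U}" if "U \<in> plus_words B" for U
      using that by (auto simp: cong_iff)
    have "inj_on ?f T"
      using onto by (fastforce simp: inj_on_def)
    moreover have "?f ` T = quot B Q"
      unfolding onto[symmetric] image_image quot_def quotient_def using f_\<phi> by auto
    moreover have "?f (mul x y) = quot_mul B Q (?f x) (?f y)" if xy: "x \<in> T" "y \<in> T" for x y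
    proof -
      obtain U V where UV: "U \<in> plus_words B" "V \<in> plus_words B" "x = \<phi> U" "y = \<phi> V"
        using xy onto by blast
      then have "?f (mul x y) = word_cong B Q `` {U @ V}"
        using f_\<phi>[OF plus_words_append[OF UV(1,2)]] hom by simp
      then show ?thesis
        unfolding UV(3,4) f_\<phi>[OF UV(1)] f_\<phi>[OF UV(2)] quot_mul_class[OF UV(1,2)] .
    qed
    ultimately show ?thesis by (simp add: semigroup_iso_def bij_betw_def)
  qed
  ultimately show ?thesis using rs by (auto simp: presented_by_def)
qed

lemma rstep_map:
  assumes "rstep B Q U V"
  shows "rstep (g ` B) (map_prod (map g) (map g) ` Q) (map g U) (map g V)"
proof -
  obtain Z1 Z2 X Y where Z: "Z1 \<in> lists B" "Z2 \<in> lists B" "(X, Y) \<in> Q"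
    "U = Z1 @ X @ Z2" "V = Z1 @ Y @ Z2"
    using assms by (auto simp: rstep_def)
  then show ?thesis unfolding rstep_def
    by (intro bexI[of _ "map g Z1"] bexI[of _ "map g Z2"] bexI[of _ "(map g X, map g Y)"])
      (auto simp: lists_image intro: rev_image_eqI)
qed

text \<open>The letters built for \<open>T\<close> are themselves words, while
  \<open>has_finite_complete_rs\<close> asks for natural numbers. Decoding maps steps to steps,
  which transports the Noetherian property; encoding does so too, hence decoding an irreducible word
  leaves it irreducible.\<close>

lemma has_finite_complete_rsI:
  fixes B :: "'b::countable set"
  assumes "finite B" "finite Q" "T \<noteq> {}"
    and rs: "rewriting_system B Q" and noeth: "noetherian_rs B Q"
    and onto: "\<phi> ` plus_words B = T"
    and hom: "\<And>U V. U \<in> plus_words B \<Longrightarrow> V \<in> plus_words B \<Longrightarrow> \<phi> (U @ V) = mul (\<phi> U) (\<phi> V)"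
    and rules: "\<And>U V. (U, V) \<in> Q \<Longrightarrow> \<phi> U = \<phi> V"
    and inj: "\<And>U V. U \<in> plus_words B \<Longrightarrow> V \<in> plus_words B \<Longrightarrow> irreducible_word B Q U \<Longrightarrow>
                irreducible_word B Q V \<Longrightarrow> \<phi> U = \<phi> V \<Longrightarrow> U = V"
  shows "has_finite_complete_rs T mul"
proof -
  let ?e = "map (to_nat :: 'b \<Rightarrow> nat)" and ?d = "map (from_nat :: nat \<Rightarrow> 'b)"
  let ?B = "to_nat ` B" and ?Q = "map_prod ?e ?e ` Q"
  have de: "?d (?e U) = U" for U by (simp add: map_idI)
  have plus: "plus_words ?B = ?e ` plus_words B"
    by (auto simp: plus_words_def lists_image)
  have B: "from_nat ` ?B = B" and Q: "map_prod ?d ?d ` ?Q = Q"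
    by (simp_all add: image_image map_prod_def case_prod_unfold de del: map_map)
  have step_d: "rstep B Q (?d U) (?d V)" if "rstep ?B ?Q U V" for U V
    using rstep_map[OF that, where g = "from_nat :: nat \<Rightarrow> 'b"] by (simp only: B Q)
  have irr_d: "irreducible_word B Q (?d U)" if irr: "irreducible_word ?B ?Q U" and U: "U \<in> plus_words ?B" for U
  proof -
    obtain U' where U': "U = ?e U'" using U plus by blast
    then show ?thesis using irr rstep_map unfolding irreducible_word_def U' de by blast
  qed
  have "presented_by T mul ?B ?Q \<and> complete_rs ?B ?Q"
  proof (rule complete_presentationI[where \<phi> = "\<phi> \<circ> ?d"])
    show "rewriting_system ?B ?Q"
      using rs unfolding rewriting_system_def plus by auto
    show "noetherian_rs ?B ?Q"
      using wf_inv_image[OF noeth[unfolded noetherian_rs_iff_wf], of ?d] step_d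
      unfolding noetherian_rs_iff_wf by (auto elim!: wf_subset)
    show "(\<phi> \<circ> ?d) ` plus_words ?B = T"
      unfolding plus image_comp[symmetric] using onto by (simp add: image_image de del: map_map)
    show "(\<phi> \<circ> ?d) (U @ V) = mul ((\<phi> \<circ> ?d) U) ((\<phi> \<circ> ?d) V)"
      if "U \<in> plus_words ?B" "V \<in> plus_words ?B" for U V
      using that hom unfolding plus by (auto simp: de simp del: map_map)
    show "(\<phi> \<circ> ?d) U = (\<phi> \<circ> ?d) V" if "(U, V) \<in> ?Q" for U V
      using that rules by (auto simp: de simp del: map_map)
    show "U = V" if "U \<in> plus_words ?B" "V \<in> plus_words ?B" "irreducible_word ?B ?Q U"
      "irreducible_word ?B ?Q V" "(\<phi> \<circ> ?d) U = (\<phi> \<circ> ?d) V" for U V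
    proof -
      have "?d U = ?d V"
        using that irr_d inj[of "?d U" "?d V"] unfolding plus by (auto simp: de simp del: map_map)
      then show ?thesis using that(1,2) unfolding plus by (auto simp: de simp del: map_map)
    qed
  qed (fact \<open>T \<noteq> {}\<close>)
  then show ?thesis using assms(1,2) unfolding has_finite_complete_rs_def by blast
qed

section \<open>Canonical factorisations\<close>

text \<open>A cut needs 2(k+1) symbols, so that the remainder also keeps more than \<open>k\<close>
  of them: all pieces of a word longer than \<open>k\<close> have lengths from k+1 to 2k+1. The
  empty word gives \<open>[[]]\<close>, so the result is never the empty list.\<close>

function chop :: "nat \<Rightarrow> 'b list \<Rightarrow> 'b list list" where
  "chop k w = (if length w < 2 * Suc k then [w] else take (Suc k) w # chop k (drop (Suc k) w))"
  by auto
termination by (relation "measure (length \<circ> snd)") auto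

declare chop.simps [simp del]

lemma concat_chop: "concat (chop k w) = w"
proof (induction k w rule: chop.induct)
  case (1 k w)
  then show ?case by (subst chop.simps) auto
qed

lemma chop_nonempty: "chop k w \<noteq> []"
  by (subst chop.simps) simp

lemma length_chop_piece:
  assumes "u \<in> set (chop k w)"
  shows "length u < 2 * Suc k"
  using assms
proof (induction k w rule: chop.induct)
  case (1 k w)
  then show ?case by (subst (asm) (2) chop.simps) (auto split: if_splits)
qed

lemma chop_piece_long:
  assumes "k < length w" "u \<in> set (chop k w)"
  shows "k < length u"
  using assms
proof (induction k w rule: chop.induct)
  case (1 k w)
  then show ?case by (subst (asm) (2) chop.simps) (auto split: if_splits)
qed

lemma chop_short: "length w < 2 * Suc k \<Longrightarrow> chop k w = [w]"
  by (simp add: chop.simps)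

section \<open>Measures of factorisations\<close>

text \<open>Counting from 1, the symbols of the i-th letter contribute i times each, so the weight
  grows when symbols move into later letters.\<close>

fun suffix_weight :: "'b list list \<Rightarrow> nat" where
  "suffix_weight [] = 0"
| "suffix_weight (u # U) = length (concat (u # U)) + suffix_weight U"

definition short_pieces :: "nat \<Rightarrow> 'b list list \<Rightarrow> nat" where
  "short_pieces k U = length (filter (\<lambda>u. length u \<le> k) U)"

text \<open>Each suffix starting in \<open>U\<close> is extended by the whole of \<open>V\<close>,
  whence the middle term.\<close>

lemma suffix_weight_append:
  "suffix_weight (U @ V) = suffix_weight U + length U * length (concat V) + suffix_weight V"
  by (induction U) (auto simp: algebra_simps)

lemma suffix_weight_le: "suffix_weight U \<le> length U * length (concat U)"
proof (induction U)
  case (Cons u U)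
  have "length U * length (concat U) \<le> length U * length (concat (u # U))" by simp
  with Cons have "suffix_weight U \<le> length U * length (concat (u # U))" by (rule le_trans)
  then show ?case by simp
qed simp

lemma length_le_length_concat: "[] \<notin> set U \<Longrightarrow> length U \<le> length (concat U)"
proof (induction U)
  case (Cons u U)
  then show ?case by (cases u) auto
qed simp

text \<open>When all letters are longer than \<open>k\<close>, \<open>chop\<close> always makes the
  shortest possible cut, so its remainders are never shorter than those of \<open>U\<close>. A
  longer \<open>w\<close> is allowed because the remainders after one cut may differ in length; the
  difference term records this excess and later supplies strictness.\<close>

lemma suffix_weight_le_chop:
  assumes "\<forall>u\<in>set U. k < length u" "length (concat U) \<le> length w"
  shows "length U \<le> length (chop k w) \<and>
    suffix_weight U + (length w - length (concat U)) \<le> suffix_weight (chop k w)"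
  using assms
proof (induction U arbitrary: w)
  case Nil
  then show ?case by (cases "chop k w") (auto dest: arg_cong[where f = concat] simp: concat_chop)
next
  case (Cons u U)
  show ?case
  proof (cases "length w < 2 * Suc k")
    case True
    \<comment> \<open>Two letters longer than \<open>k\<close> would already need 2(k+1)
      symbols.\<close>
    then have "U = []" using Cons.prems by (cases U) auto
    then show ?thesis using True Cons.prems by (simp add: chop_short)
  next
    case False
    have "length U \<le> length (chop k (drop (Suc k) w)) \<and> suffix_weight U +
        (length (drop (Suc k) w) - length (concat U)) \<le> suffix_weight (chop k (drop (Suc k) w))"
      using Cons.prems False by (intro Cons.IH) auto
    moreover have "chop k w = take (Suc k) w # chop k (drop (Suc k) w)"
      using False by (subst chop.simps) simp
    ultimately show ?thesis using Cons.prems False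
      by (auto simp: concat_chop)
  qed
qed

text \<open>The two factorisations agree while letters of length k+1 are cut off. At the first
  deviation the letter of \<open>U\<close> is longer, so the canonical remainder is strictly longer
  and the excess in \<open>suffix_weight_le_chop\<close> is positive.\<close>

lemma suffix_weight_less_chop:
  assumes "\<forall>u\<in>set U. k < length u" "U \<noteq> []" "U \<noteq> chop k (concat U)"
  shows "suffix_weight U < suffix_weight (chop k (concat U))"
  using assms
proof (induction U)
  case (Cons u U)
  let ?w = "concat (u # U)"
  have long: "\<not> length ?w < 2 * Suc k"
  proof
    assume short: "length ?w < 2 * Suc k"
    then have "U = []" using Cons.prems(1) by (cases U) auto
    then show False using Cons.prems(3) short by (simp add: chop_short)
  qed
  then have chop: "chop k ?w = take (Suc k) ?w # chop k (drop (Suc k) ?w)"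
    by (subst chop.simps) simp
  have "suffix_weight U < suffix_weight (chop k (drop (Suc k) ?w))"
  proof (cases "length u = Suc k")
    case True
    then have "U \<noteq> []" using long by auto
    then show ?thesis using Cons True chop by auto
  next
    case False
    then have "Suc k < length u" using Cons.prems(1) by auto
    then have "length (concat U) < length (drop (Suc k) ?w)" by simp
    then show ?thesis using suffix_weight_le_chop[of U k "drop (Suc k) ?w"] Cons.prems(1)
      by auto
  qed
  then show ?case unfolding chop by (simp add: concat_chop)
qed simp

lemma short_pieces_append: "short_pieces k (U @ V) = short_pieces k U + short_pieces k V"
  by (simp add: short_pieces_def)

text \<open>A word of at most \<open>k\<close> symbols has only short letters but a single canonical
  piece; a longer word has no short canonical piece. So recutting a non-canonical \<open>U\<close>
  lowers the count unless no letter was short.\<close>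

lemma short_pieces_chop:
  assumes "short_pieces k U \<le> short_pieces k (chop k (concat U))" "U \<noteq> []" "[] \<notin> set U"
    and "chop k (concat U) \<noteq> U"
  shows "\<forall>u\<in>set U. k < length u"
proof (cases "length (concat U) \<le> k")
  case True
  have "\<forall>u\<in>set U. length u \<le> k"
  proof
    fix u
    assume "u \<in> set U"
    then obtain P Q where "U = P @ u # Q" by (meson split_list)
    then show "length u \<le> k" using True by simp
  qed
  then have "short_pieces k U = length U" by (simp add: short_pieces_def)
  moreover have "chop k (concat U) = [concat U]" using True by (simp add: chop_short)
  ultimately have "length U \<le> 1" using assms(1) True by (simp add: short_pieces_def)
  then obtain u where "U = [u]" using assms(2) by (cases U) auto
  then show ?thesis using assms(4) True by (simp add: chop_short)
next
  case False
  then have "short_pieces k (chop k (concat U)) = 0"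
    using chop_piece_long[of k "concat U"] by (fastforce simp: short_pieces_def filter_empty_conv)
  then show ?thesis using assms(1) by (auto simp: short_pieces_def filter_empty_conv)
qed

section \<open>Local tests: adjacent letters and covered factors\<close>

text \<open>A canonical pair \<open>[u, v]\<close> has at least 2(k+1) symbols and \<open>u\<close>
  has length k+1, so the first cut of the whole word falls at the end of \<open>u\<close>, and
  induction continues behind it.\<close>

lemma chop_concat_eq_of_pairs:
  assumes "U \<noteq> []" "\<forall>u\<in>set U. length u < 2 * Suc k"
    and "\<And>P u v Q. U = P @ [u, v] @ Q \<Longrightarrow> chop k (u @ v) = [u, v]"
  shows "chop k (concat U) = U"
  using assms
proof (induction U)
  case (Cons u U)
  show ?case
  proof (cases U)
    case Nil
    then show ?thesis using Cons.prems(2) by (simp add: chop_short)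
  next
    case (Cons v U')
    have pair: "chop k (u @ v) = [u, v]"
      using Cons.prems(3)[of "[]" u v U'] Cons by simp
    then have long: "2 * Suc k \<le> length (u @ v)"
      using chop_short by (metis list.inject list.discI not_less)
    then have "chop k (u @ v) = take (Suc k) (u @ v) # chop k (drop (Suc k) (u @ v))"
      by (subst chop.simps) simp
    then have u: "take (Suc k) (u @ v) = u" using pair by simp
    have lenu: "length u = Suc k"
    proof -
      have "length (take (Suc k) (u @ v)) = Suc k" using long by simp
      then show ?thesis unfolding u .
    qed
    have "chop k (concat U) = U"
    proof (rule Cons.IH)
      show "chop k (x @ y) = [x, y]" if "U = P @ [x, y] @ Q" for P x y Q
        using Cons.prems(3)[of "u # P" x y Q] that by simp
    qed (use Cons Cons.prems(2) in auto)
    moreover have "chop k (concat (u # U)) = u # chop k (concat U)"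
      using long lenu Cons by (subst chop.simps) simp
    ultimately show ?thesis by simp
  qed
qed simp

text \<open>Besides the letters in which \<open>X\<close> begins and ends, only letters lying inside
  \<open>X\<close> are used; being nonempty, there are at most \<open>length X\<close> of
  them.\<close>

lemma concat_factor:
  assumes "concat U = P @ X @ Q" "X \<noteq> []" "[] \<notin> set U"
  obtains U1 U2 U3 P' Q' where "U = U1 @ U2 @ U3" "concat U2 = P' @ X @ Q'" "U2 \<noteq> []"
    "length U2 \<le> length X + 2"
proof -
  have "U \<noteq> []" using assms(1,2) by auto
  then obtain U1 p p' V where V: "U = U1 @ (p @ p') # V" "X @ Q = p' @ concat V"
    using concat_eq_appendD[OF assms(1)] by blast
  \<comment> \<open>\<open>p'\<close> is the part of a letter from the start of \<open>X\<close>
    onwards. With it in front, \<open>X\<close> becomes a prefix, and the same splitting fact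
    locates its end.\<close>
  have "concat (p' # V) = X @ Q" using V(2) by simp
  then obtain V1 q q' V2 where V': "p' # V = V1 @ (q @ q') # V2" "X = concat V1 @ q"
    using concat_eq_appendD[of "p' # V" X Q] by blast
  show thesis
  proof (cases V1)
    case Nil
    then show thesis
      using V V' by (intro that[of U1 "[p @ p']" V p q']) auto
  next
    case (Cons r V1')
    then have r: "r = p'" "V = V1' @ (q @ q') # V2" using V'(1) by auto
    have "[] \<notin> set V1'" using assms(3) V(1) r by auto
    then have "length V1' \<le> length X"
      using length_le_length_concat[of V1'] V'(2) Cons by (simp)
    then show thesis
      using V V' Cons r by (intro that[of U1 "(p @ p') # V1' @ [q @ q']" V2 p q']) auto
  qed
qed

section \<open>Large subsemigroups\<close>

text \<open>The ambient semigroup is represented by the evaluation \<open>\<phi>\<close> of words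
  over \<open>A\<close>, and the finiteness of the complement of \<open>T\<close> by the bound
  \<open>k\<close> in \<open>long_in_T\<close>.\<close>

locale large_subsemigroup =
  fixes A :: "'b set" and R :: "('b list \<times> 'b list) set"
    and T :: "'a set" and mul :: "'a \<Rightarrow> 'a \<Rightarrow> 'a" and \<phi> :: "'b list \<Rightarrow> 'a" and k :: nat
  assumes rs: "rewriting_system A R" and noeth: "noetherian_rs A R" and conf: "confluent_rs A R"
    and fin: "finite A" "finite R"
    and hom: "\<And>U V. U \<in> plus_words A \<Longrightarrow> V \<in> plus_words A \<Longrightarrow> \<phi> (U @ V) = mul (\<phi> U) (\<phi> V)"
    and eval_eq: "\<And>U V. U \<in> plus_words A \<Longrightarrow> V \<in> plus_words A \<Longrightarrow>
                    \<phi> U = \<phi> V \<longleftrightarrow> equivclp (rstep A R) U V"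
    and T_image: "T \<subseteq> \<phi> ` plus_words A" and T_nonempty: "T \<noteq> {}"
    and T_closed: "\<And>x y. x \<in> T \<Longrightarrow> y \<in> T \<Longrightarrow> mul x y \<in> T"
    and long_in_T: "\<And>w. w \<in> plus_words A \<Longrightarrow> irreducible_word A R w \<Longrightarrow> k < length w \<Longrightarrow> \<phi> w \<in> T"
begin

definition letters :: "'b list set" where
  "letters = {w \<in> plus_words A. irreducible_word A R w \<and> \<phi> w \<in> T \<and> length w < 2 * Suc k}"

definition canon :: "'b list list \<Rightarrow> 'b list list" where
  "canon U = chop k (normal_form A R (concat U))"

text \<open>An occurrence of a left-hand side \<open>X\<close> of \<open>R\<close> in a concatenation of letters
  is covered by at most \<open>length X + 2\<close> letters.\<close>

definition max_length :: nat where
  "max_length = Max (insert 0 ((length \<circ> fst) ` R)) + 2"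

definition rules :: "('b list list \<times> 'b list list) set" where
  "rules = {(U, canon U) | U. U \<in> plus_words letters \<and> length U \<le> max_length \<and> canon U \<noteq> U}"

lemma normal_form_in: "U \<in> plus_words A \<Longrightarrow> normal_form A R U \<in> plus_words A"
  using normal_form[OF noeth] rsteps_plus_words[OF rs] by blast

lemma normal_form_eval: "U \<in> plus_words A \<Longrightarrow> \<phi> (normal_form A R U) = \<phi> U"
  using eval_eq normal_form_in normal_form[OF noeth] by (metis converse_rtranclp_into_equivclp)

lemma normal_form_irreducible: "irreducible_word A R U \<Longrightarrow> normal_form A R U = U"
  using normal_form[OF noeth] rsteps_from_irreducible by metis

lemma irreducible_eval_inj:
  assumes "U \<in> plus_words A" "V \<in> plus_words A" "irreducible_word A R U" "irreducible_word A R V"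
    and "\<phi> U = \<phi> V"
  shows "U = V"
  using assms eval_eq church_rosser[OF rs conf] rsteps_from_irreducible by metis

lemma finite_letters: "finite letters"
proof (rule finite_subset)
  show "letters \<subseteq> {w. set w \<subseteq> A \<and> length w \<le> 2 * Suc k}"
    by (auto simp: letters_def plus_words_def)
qed (rule finite_lists_length_le[OF fin(1)])

lemma Nil_notin_letters: "[] \<notin> letters"
  by (simp add: letters_def plus_words_def)

lemma concat_lists_letters: "U \<in> lists letters \<Longrightarrow> concat U \<in> lists A"
  by (fastforce simp: letters_def plus_words_def in_lists_conv_set)

lemma concat_letters:
  assumes "U \<in> plus_words letters"
  shows "concat U \<in> plus_words A" "\<phi> (concat U) \<in> T"
proof -
  have "concat U \<in> plus_words A \<and> \<phi> (concat U) \<in> T"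
    using assms
  proof (induction U)
    case (Cons u U)
    then have u: "u \<in> plus_words A" "\<phi> u \<in> T" by (auto simp: letters_def plus_words_def)
    show ?case
    proof (cases "U = []")
      case False
      then have "U \<in> plus_words letters" using Cons.prems by (auto simp: plus_words_def)
      then show ?thesis using u Cons.IH hom T_closed by (auto intro: plus_words_append)
    qed (use u in simp)
  qed (simp add: plus_words_def)
  then show "concat U \<in> plus_words A" "\<phi> (concat U) \<in> T" by auto
qed

text \<open>A word that is not cut is its own letter. Otherwise every piece is an irreducible factor
  with more than \<open>k\<close> symbols, so \<open>long_in_T\<close> puts its value into
  \<open>T\<close>.\<close>

lemma chop_letters:
  assumes "w \<in> plus_words A" "irreducible_word A R w" "\<phi> w \<in> T"
  shows "chop k w \<in> plus_words letters"
proof -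
  have "u \<in> letters" if u: "u \<in> set (chop k w)" for u
  proof (cases "length w < 2 * Suc k")
    case True
    then show ?thesis using assms u by (simp add: chop_short letters_def)
  next
    case False
    then have long: "k < length u" using chop_piece_long[OF _ u] by simp
    obtain P Q where "chop k w = P @ u # Q" using u by (meson split_list)
    then have w: "w = concat P @ u @ concat Q" using concat_chop[of k w] by simp
    then have "concat P \<in> lists A" "concat Q \<in> lists A" "u \<in> plus_words A"
      using assms(1) long by (auto simp: plus_words_def)
    moreover from this have "irreducible_word A R u"
      using assms(2) w irreducible_word_factor by metis
    ultimately show ?thesis
      using long long_in_T length_chop_piece[OF u] by (simp add: letters_def)
  qed
  then show ?thesis using chop_nonempty by (auto simp: plus_words_def)
qed

lemma canon_letters: "U \<in> plus_words letters \<Longrightarrow> canon U \<in> plus_words letters"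
  by (simp add: canon_def chop_letters concat_letters normal_form_in normal_form_eval
      normal_form[OF noeth])

lemma rewriting_system_rules: "rewriting_system letters rules"
  using canon_letters by (auto simp: rewriting_system_def rules_def)

lemma finite_rules: "finite rules"
proof (rule finite_subset)
  show "rules \<subseteq> (\<lambda>U. (U, canon U)) ` {U. set U \<subseteq> letters \<and> length U \<le> max_length}"
    by (auto simp: rules_def plus_words_def)
qed (intro finite_imageI finite_lists_length_le[OF finite_letters])

lemma rules_eval: "(U, V) \<in> rules \<Longrightarrow> \<phi> (concat U) = \<phi> (concat V)"
  by (auto simp: rules_def canon_def concat_chop concat_letters normal_form_eval)

section \<open>Irreducible words of the new system\<close>

text \<open>Since no rule applies, each nonempty factor of at most \<open>max_length\<close> letters
  is fixed by \<open>canon\<close>. Factors covering a left-hand side of \<open>R\<close> give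
  irreducibility of the concatenation; adjacent pairs then give canonicity.\<close>

lemma irreducible_rules_canon:
  assumes U: "U \<in> plus_words letters" and irr: "irreducible_word letters rules U"
  shows "irreducible_word A R (concat U)" "chop k (concat U) = U"
proof -
  have canon: "canon V = V"
    if UPQ: "U = P @ V @ Q" and V: "V \<noteq> []" "length V \<le> max_length" for P V Q
  proof (rule ccontr)
    assume "canon V \<noteq> V"
    moreover have "V \<in> plus_words letters" "P \<in> lists letters" "Q \<in> lists letters"
      using U UPQ V by (auto simp: plus_words_def)
    ultimately have "rstep letters rules U (P @ canon V @ Q)"
      using UPQ V(2) unfolding rstep_def rules_def by blast
    then show False using irr by (auto simp: irreducible_word_def)
  qed
  have nil: "[] \<notin> set U" using U Nil_notin_letters by (auto simp: plus_words_def)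
  show irr_concat: "irreducible_word A R (concat U)"
  proof (rule ccontr)
    assume "\<not> irreducible_word A R (concat U)"
    then obtain P X Q Y where XY: "concat U = P @ X @ Q" "(X, Y) \<in> R"
      by (auto simp: irreducible_word_def rstep_def)
    then have "X \<noteq> []" using rs by (auto simp: rewriting_system_def plus_words_def)
    then obtain U1 U2 U3 P' Q' where U2: "U = U1 @ U2 @ U3" "concat U2 = P' @ X @ Q'" "U2 \<noteq> []"
      "length U2 \<le> length X + 2"
      using concat_factor[OF XY(1)] nil by metis
    have "length X \<le> Max (insert 0 ((length \<circ> fst) ` R))"
      using XY(2) fin(2) by (intro Max_ge) force+
    then have "canon U2 = U2"
      using canon U2 by (simp add: max_length_def)
    \<comment> \<open>A list fixed by \<open>canon\<close> concatenates to a normal form, which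
      cannot contain the left-hand side \<open>X\<close>.\<close>
    then have "concat U2 = normal_form A R (concat U2)"
      by (metis canon_def concat_chop)
    then have "irreducible_word A R (P' @ X @ Q')"
      using normal_form[OF noeth] U2(2) by metis
    moreover have "P' \<in> lists A" "Q' \<in> lists A"
    proof -
      have "set (concat U2) \<subseteq> A" using U U2(1) by (auto simp: plus_words_def letters_def)
      then show "P' \<in> lists A" "Q' \<in> lists A" unfolding U2(2) by auto
    qed
    ultimately show False
      using XY(2) unfolding irreducible_word_def rstep_def by blast
  qed
  show "chop k (concat U) = U"
  proof (rule chop_concat_eq_of_pairs)
    show "U \<noteq> []" "\<forall>u\<in>set U. length u < 2 * Suc k"
      using U by (auto simp: plus_words_def letters_def)
    fix P u v Q
    assume UPQ: "U = P @ [u, v] @ Q"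
    have "concat P \<in> lists A" "concat Q \<in> lists A"
      using U UPQ by (auto simp: plus_words_def intro!: concat_lists_letters)
    moreover have "concat U = concat P @ (u @ v) @ concat Q" using UPQ by simp
    ultimately have "irreducible_word A R (u @ v)"
      using irr_concat irreducible_word_factor by metis
    \<comment> \<open>The summand 2 in \<open>max_length\<close> admits pairs whatever
      \<open>R\<close> is.\<close>
    moreover have "canon [u, v] = [u, v]"
      using canon[OF UPQ] by (simp add: max_length_def)
    ultimately show "chop k (u @ v) = [u, v]"
      by (simp add: canon_def normal_form_irreducible)
  qed
qed

section \<open>Termination of the new system\<close>

text \<open>Lexicographic: \<open>R\<close>-reduction of the concatenation, then the number of letters of length
  at most \<open>k\<close>, then the total length of all suffixes, which grows.\<close>

definition descent :: "('b list list \<times> 'b list list) set" where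
  "descent = inv_image ({(V, U). rstep A R U V}\<^sup>+ <*lex*>
       measures [short_pieces k, \<lambda>U. (length (concat U))\<^sup>2 - suffix_weight U])
     (\<lambda>U. (concat U, U))"

lemma wf_descent: "wf descent"
  using noeth unfolding descent_def noetherian_rs_iff_wf
  by (intro wf_inv_image wf_lex_prod wf_trancl wf_measures)

text \<open>If the concatenation of the left-hand side is reducible, its normal form is at least one
  step away. Otherwise the concatenation is unchanged and one of the two measures of the
  factorisation decreases.\<close>

lemma rules_descent:
  assumes "rstep letters rules U V"
  shows "(V, U) \<in> descent"
proof -
  obtain P L Q where PQ: "P \<in> lists letters" "Q \<in> lists letters"
    and L: "L \<in> plus_words letters" "canon L \<noteq> L"
    and U: "U = P @ L @ Q" and V: "V = P @ canon L @ Q"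
    using assms by (auto simp: rstep_def rules_def)
  have A: "concat P \<in> lists A" "concat Q \<in> lists A"
    by (fact concat_lists_letters[OF PQ(1)] concat_lists_letters[OF PQ(2)])+
  let ?n = "normal_form A R (concat L)"
  have nf: "(rstep A R)\<^sup>*\<^sup>* (concat L) ?n" using normal_form[OF noeth] by blast
  show ?thesis
  proof (cases "irreducible_word A R (concat L)")
    case True
    then have cL: "canon L = chop k (concat L)"
      by (simp add: canon_def normal_form_irreducible)
    have concat: "concat V = concat U" by (simp add: U V cL concat_chop)
    have L': "L \<noteq> []" "[] \<notin> set L" using L Nil_notin_letters by (auto simp: plus_words_def)
    show ?thesis
    proof (cases "short_pieces k L \<le> short_pieces k (canon L)")
      case True
      then have long: "\<forall>u\<in>set L. k < length u"
        using short_pieces_chop L(2) L' cL by metis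
      then have "short_pieces k L = 0" by (auto simp: short_pieces_def filter_empty_conv)
      moreover have "short_pieces k (canon L) = 0"
      proof -
        obtain u L'' where "L = u # L''" using L' by (cases L) auto
        then have "k < length (concat L)" using long by auto
        then show ?thesis
          using chop_piece_long cL by (fastforce simp: short_pieces_def filter_empty_conv)
      qed
      ultimately have short: "short_pieces k V = short_pieces k U"
        by (simp add: U V short_pieces_append)
      \<comment> \<open>The symbols of \<open>Q\<close> are counted again for every letter to their
        left, so it matters that recutting does not lower the number of letters.\<close>
      have "length L * length (concat Q) \<le> length (canon L) * length (concat Q)"
        using suffix_weight_le_chop[of L k "concat L"] long cL by simp
      moreover have "suffix_weight L < suffix_weight (canon L)"
        using suffix_weight_less_chop[of L k] long L L' cL by simp
      moreover have "length (concat (canon L)) = length (concat L)"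
        unfolding cL concat_chop ..
      ultimately have "suffix_weight U < suffix_weight V"
        unfolding U V suffix_weight_append concat_append length_append
        by (simp add: add_less_le_mono del: mult_le_cancel2)
      \<comment> \<open>Subtraction of naturals is truncated; this bound makes the growth of the
        weight a strict decrease of the difference.\<close>
      moreover have "suffix_weight V \<le> (length (concat V))\<^sup>2"
      proof -
        have "V \<in> lists letters" using V PQ canon_letters L(1) by (auto simp: plus_words_def)
        then have "length V \<le> length (concat V)"
          using Nil_notin_letters by (intro length_le_length_concat) auto
        then show ?thesis
          using suffix_weight_le[of V] by (metis le_trans mult_le_mono1 power2_eq_square)
      qed
      ultimately show ?thesis using concat short by (simp add: descent_def diff_less_mono2)
    next
      case False
      then show ?thesis using concat by (simp add: descent_def U V short_pieces_append)
    qed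
  next
    case False
    then have "?n \<noteq> concat L" using normal_form[OF noeth] by metis
    then have "(rstep A R)\<^sup>+\<^sup>+ (concat L) ?n" using nf by (metis rtranclpD)
    then have "(concat V, concat U) \<in> {(V, U). rstep A R U V}\<^sup>+"
      using rsteps_context[OF _ A] by (simp add: U V canon_def concat_chop)
    then show ?thesis by (simp add: descent_def)
  qed
qed

end

theorem theorem1p1:
  fixes S T :: "'a set" and mul :: "'a \<Rightarrow> 'a \<Rightarrow> 'a"
  assumes "is_semigroup S mul"
    and "is_subsemigroup T S mul"
    and "finite (S - T)"
    and "has_finite_complete_rs S mul"
  shows "has_finite_complete_rs T mul"
proof -
  obtain A :: "nat set" and R where fin: "finite A" "finite R" and pres: "presented_by S mul A R"
    and compl: "noetherian_rs A R" "confluent_rs A R"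
    using assms(4) by (auto simp: has_finite_complete_rs_def complete_rs_def)
  then have rs: "rewriting_system A R" by (simp add: presented_by_def)
  obtain \<phi> where onto: "\<phi> ` plus_words A = S"
    and hom: "\<And>U V. U \<in> plus_words A \<Longrightarrow> V \<in> plus_words A \<Longrightarrow> \<phi> (U @ V) = mul (\<phi> U) (\<phi> V)"
    and eval_eq: "\<And>U V. U \<in> plus_words A \<Longrightarrow> V \<in> plus_words A \<Longrightarrow>
                    \<phi> U = \<phi> V \<longleftrightarrow> equivclp (rstep A R) U V"
    using presented_by_evaluation[OF assms(1) pres] by metis
  \<comment> \<open>By confluence each element of the finite set \<open>S - T\<close> has at most
    one irreducible representative, so \<open>N\<close> is finite; \<open>k\<close> bounds the
    lengths of its words.\<close>
  define N where "N = {w \<in> plus_words A. irreducible_word A R w \<and> \<phi> w \<in> S - T}"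
  have "inj_on \<phi> N"
    unfolding inj_on_def N_def
    using eval_eq church_rosser[OF rs compl(2)] rsteps_from_irreducible
    by (metis (no_types, lifting) mem_Collect_eq)
  moreover have "finite (\<phi> ` N)"
    using assms(3) by (rule finite_subset[rotated]) (auto simp: N_def)
  ultimately have "finite (length ` N)" by (simp add: finite_image_iff)
  then obtain k where k: "\<And>w. w \<in> N \<Longrightarrow> length w \<le> k"
    by (auto simp: finite_nat_set_iff_bounded_le)
  interpret large_subsemigroup A R T mul \<phi> k
  proof
    show "T \<subseteq> \<phi> ` plus_words A" "T \<noteq> {}" "\<And>x y. x \<in> T \<Longrightarrow> y \<in> T \<Longrightarrow> mul x y \<in> T"
      using assms(2) onto by (auto simp: is_subsemigroup_def)
    show "\<phi> w \<in> T" if "w \<in> plus_words A" "irreducible_word A R w" "k < length w" for w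
      using that k[of w] onto by (auto simp: N_def)
  qed (fact rs compl fin hom eval_eq)+
  show ?thesis
  proof (rule has_finite_complete_rsI[where \<phi> = "\<phi> \<circ> concat"])
    show "finite letters" "finite rules" "T \<noteq> {}" "rewriting_system letters rules"
      by (fact finite_letters finite_rules T_nonempty rewriting_system_rules)+
    show "noetherian_rs letters rules"
      unfolding noetherian_rs_iff_wf using wf_descent by (rule wf_subset) (auto dest: rules_descent)
    show "(\<phi> \<circ> concat) ` plus_words letters = T"
    proof
      show "(\<phi> \<circ> concat) ` plus_words letters \<subseteq> T" using concat_letters by auto
      show "T \<subseteq> (\<phi> \<circ> concat) ` plus_words letters"
      proof
        fix t
        assume t: "t \<in> T"
        then obtain w where w: "w \<in> plus_words A" "t = \<phi> w" using T_image by auto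
        let ?n = "normal_form A R w"
        have "chop k ?n \<in> plus_words letters"
          using w t
          by (intro chop_letters)
            (simp_all add: normal_form_in normal_form_eval normal_form[OF noeth])
        moreover have "(\<phi> \<circ> concat) (chop k ?n) = t"
          using w by (simp add: concat_chop normal_form_eval)
        ultimately show "t \<in> (\<phi> \<circ> concat) ` plus_words letters" by (metis imageI)
      qed
    qed
    show "(\<phi> \<circ> concat) (U @ V) = mul ((\<phi> \<circ> concat) U) ((\<phi> \<circ> concat) V)"
      if "U \<in> plus_words letters" "V \<in> plus_words letters" for U V
      using that by (simp add: hom concat_letters)
    show "(\<phi> \<circ> concat) U = (\<phi> \<circ> concat) V" if "(U, V) \<in> rules" for U V
      using that by (simp add: rules_eval)
    show "U = V" if "U \<in> plus_words letters" "V \<in> plus_words letters"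
      "irreducible_word letters rules U" "irreducible_word letters rules V"
      "(\<phi> \<circ> concat) U = (\<phi> \<circ> concat) V" for U V
    proof -
      \<comment> \<open>Both concatenations are irreducible for \<open>R\<close> and have the same
        value, hence agree; canonical factorisation then recovers \<open>U\<close> and
        \<open>V\<close> from them.\<close>
      have "concat U = concat V"
        using that irreducible_rules_canon(1) concat_letters(1) by (intro irreducible_eval_inj) auto
      then show ?thesis using that irreducible_rules_canon(2) by metis
    qed
  qed
qed

end
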